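(* For every $d\in\mathbb{N}$ and every $0\le k<d$, there exists an infinite sequence $\{\mathcal{F}_n\}_{n\in\mathbb{N}}$ of families of axis-parallel boxes in $\mathbb{R}^d$ such that: (1) for every $n\in\mathbb{N}$, $\mathcal{F}_n$ has no finite axis-parallel $k$-transversal (no finite family of axis-parallel $k$-flats such that every box of $\mathcal{F}_n$ meets one of them); and (2) every infinite sequence $\{B_n\}_{n\in\mathbb{N}}$ with $B_n\in\mathcal{F}_n$ for all $n\in\mathbb{N}$ contains two boxes $B_i,B_j$ with $i\neq j$ that are both intersected by a single axis-parallel $k$-flat.
   Context: An axis-parallel box in $\mathbb{R}^d$ is a set $[a_1,b_1]\times\cdots\times[a_d,b_d]$ with $a_i\le b_i$ real for all $i$. An axis-parallel $k$-flat in $\mathbb{R}^d$ is a set of the form $\{x\in\mathbb{R}^d : x_i=c_i \text{ for all } i\in I\}$ where $I\subseteq\{1,\dots,d\}$ has $|I|=d-k$ and $c_i\in\mathbb{R}$ are fixed. *)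

theory Defs
  imports "HOL-Analysis.Analysis"
begin

text \<open>The space \<open>\<real>\<^sup>d\<close> is \<^typ>\<open>real ^ 'd\<close> with \<open>d = CARD('d)\<close>.\<close>

definition axis_box :: "(real ^ 'd) set \<Rightarrow> bool" where
  "axis_box B \<longleftrightarrow> (\<exists>a b. (\<forall>i. a $ i \<le> b $ i) \<and> B = cbox a b)"

text \<open>The condition \<open>card I = d - k\<close> is written additively to avoid truncated subtraction.\<close>

definition axis_flat :: "nat \<Rightarrow> (real ^ 'd) set \<Rightarrow> bool" where
  "axis_flat k L \<longleftrightarrow>
     (\<exists>(I :: 'd set) (c :: 'd \<Rightarrow> real). card I + k = CARD('d) \<and> L = {x. \<forall>i\<in>I. x $ i = c i})"

definition axis_transversal :: "nat \<Rightarrow> (real ^ 'd) set set \<Rightarrow> (real ^ 'd) set set \<Rightarrow> bool" where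
  "axis_transversal k T \<F> \<longleftrightarrow>
     (\<forall>L\<in>T. axis_flat k L) \<and> (\<forall>B\<in>\<F>. \<exists>L\<in>T. B \<inter> L \<noteq> {})"

end

theory Submission
  imports Defs
begin

text \<open>
  Let \<open>\<F> 0\<close> consist of the diagonal unit cubes \<open>[m, m + 1]\<^sup>d\<close> with \<open>m \<ge> 1\<close>, and let \<open>\<F> n\<close>, for
  \<open>n \<ge> 1\<close>, consist of the single points on the diagonal of the \<open>n\<close>-th cube. Each family is
  infinite, while an axis-parallel hyperplane, and hence an axis-parallel flat of dimension less
  than \<open>d\<close>, meets at most finitely many members of it. Whichever cube \<open>[m, m + 1]\<^sup>d\<close> is chosen from
  \<open>\<F> 0\<close>, it contains the point chosen from \<open>\<F> m\<close>.
\<close>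

text \<open>Since \<open>k < CARD('d)\<close>, a flat fixes at least one coordinate; dropping all
  other constraints leaves a hyperplane containing it.\<close>

lemma axis_flat_subset_hyperplane:
  fixes L :: "(real ^ 'd) set"
  assumes "axis_flat k L" "k < CARD('d)"
  obtains i c where "L \<subseteq> {x. x $ i = c}"
proof -
  obtain I c where I: "card I + k = CARD('d)" and L: "L = {x. \<forall>i\<in>I. x $ i = c i}"
    using assms(1) unfolding axis_flat_def by blast
  from I assms(2) have "I \<noteq> {}" by auto
  then obtain i where "i \<in> I" by blast
  with L have "L \<subseteq> {x. x $ i = c i}" by blast
  then show thesis by (rule that)
qed

text \<open>Freeze any \<open>CARD('d) - k\<close> coordinates at their values in \<open>p\<close>.
  Hence two boxes with a common point always share a flat.\<close>

lemma axis_flat_through_point: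
  fixes p :: "real ^ 'd"
  assumes "k \<le> CARD('d)"
  shows "\<exists>L. axis_flat k L \<and> p \<in> L"
proof -
  obtain I :: "'d set" where "card I = CARD('d) - k"
    using ex_card[of "CARD('d) - k" "UNIV :: 'd set"] by auto
  with assms have "axis_flat k {x. \<forall>i\<in>I. x $ i = p $ i}"
    unfolding axis_flat_def by (intro exI[of _ I] exI[of _ "($) p"]) simp
  then show ?thesis by (intro exI conjI) auto
qed

text \<open>Pigeonhole: finitely many flats, each meeting only finitely many members, cannot reach
  all of an infinite family.\<close>

lemma no_finite_axis_transversal:
  fixes \<F> :: "(real ^ 'd) set set"
  assumes "k < CARD('d)" "infinite \<F>"
    and hyperplane: "\<And>i c. finite {B \<in> \<F>. \<exists>x\<in>B. x $ i = c}"
  shows "\<not> (\<exists>T. finite T \<and> axis_transversal k T \<F>)"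
proof
  assume "\<exists>T. finite T \<and> axis_transversal k T \<F>"
  then obtain T where T: "finite T" "\<forall>L\<in>T. axis_flat k L"
      and meets: "\<forall>B\<in>\<F>. \<exists>L\<in>T. B \<inter> L \<noteq> {}"
    unfolding axis_transversal_def by (elim exE conjE)
  have "finite {B \<in> \<F>. B \<inter> L \<noteq> {}}" if L: "L \<in> T" for L
  proof -
    obtain i c where "L \<subseteq> {x. x $ i = c}"
      using axis_flat_subset_hyperplane[OF bspec[OF T(2) L] assms(1)] .
    then have "{B \<in> \<F>. B \<inter> L \<noteq> {}} \<subseteq> {B \<in> \<F>. \<exists>x\<in>B. x $ i = c}" by blast
    then show ?thesis using hyperplane by (rule finite_subset)
  qed
  with T(1) have "finite (\<Union>L\<in>T. {B \<in> \<F>. B \<inter> L \<noteq> {}})" by (rule finite_UN_I)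
  moreover have "\<F> \<subseteq> (\<Union>L\<in>T. {B \<in> \<F>. B \<inter> L \<noteq> {}})" using meets by blast
  ultimately have "finite \<F>" by (rule finite_subset[rotated])
  with assms(2) show False ..
qed

definition diagonal_cube :: "nat \<Rightarrow> (real ^ 'd) set" where
  "diagonal_cube m = cbox (vec (real m)) (vec (real m + 1))"

text \<open>The cubes start at index 1 so that the index of a cube is never 0, the index of the
  family of cubes itself.\<close>

definition diagonal_family :: "nat \<Rightarrow> (real ^ 'd) set set" where
  "diagonal_family n =
     (if n = 0 then diagonal_cube ` {1..} else (\<lambda>t. {vec t}) ` {real n..real n + 1})"

lemma mem_diagonal_cube:
  "x \<in> diagonal_cube m \<longleftrightarrow> (\<forall>i. real m \<le> x $ i \<and> x $ i \<le> real m + 1)"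
  by (simp add: diagonal_cube_def mem_box_cart)

text \<open>If two cubes coincide, each contains the lowest corner of the other, which bounds each
  index by the other.\<close>

lemma inj_diagonal_cube: "inj (diagonal_cube :: nat \<Rightarrow> (real ^ 'd) set)"
proof (rule injI)
  fix m n assume eq: "(diagonal_cube m :: (real ^ 'd) set) = diagonal_cube n"
  have "(vec (real m) :: real ^ 'd) \<in> diagonal_cube m" "(vec (real n) :: real ^ 'd) \<in> diagonal_cube n"
    by (auto simp: mem_diagonal_cube)
  with eq have "(vec (real m) :: real ^ 'd) \<in> diagonal_cube n" "(vec (real n) :: real ^ 'd) \<in> diagonal_cube m"
    by auto
  then show "m = n" by (simp add: mem_diagonal_cube)
qed

lemma axis_box_diagonal_family:
  assumes "B \<in> diagonal_family n"
  shows "axis_box B"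
proof (cases "n = 0")
  case True
  with assms obtain m where "B = diagonal_cube m" by (auto simp: diagonal_family_def)
  then show ?thesis
    unfolding axis_box_def diagonal_cube_def
    by (intro exI[of _ "vec (real m)"] exI[of _ "vec (real m + 1)"]) simp
next
  case False
  with assms obtain t where "B = {vec t}" by (auto simp: diagonal_family_def)
  then show ?thesis
    unfolding axis_box_def by (intro exI[of _ "vec t"]) simp
qed

lemma infinite_diagonal_family: "infinite (diagonal_family n :: (real ^ 'd) set set)"
proof (cases "n = 0")
  case True
  have "infinite ((diagonal_cube :: nat \<Rightarrow> (real ^ 'd) set) ` {1..})"
    by (simp add: finite_image_iff inj_on_subset[OF inj_diagonal_cube subset_UNIV] infinite_Ici)
  with True show ?thesis by (simp add: diagonal_family_def)
next
  case False
  have "inj_on (\<lambda>t. {vec t :: real ^ 'd}) {real n..real n + 1}"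
    by (rule inj_onI) (simp add: vec_eq_iff)
  then have "infinite ((\<lambda>t. {vec t :: real ^ 'd}) ` {real n..real n + 1})"
    by (simp add: finite_image_iff infinite_Icc)
  with False show ?thesis by (simp add: diagonal_family_def)
qed

lemma finite_diagonal_family_meets_hyperplane:
  fixes i :: "'d::finite"
  shows "finite {B \<in> diagonal_family n. \<exists>x\<in>B. x $ i = c}"
proof (cases "n = 0")
  case True
  \<comment> \<open>A cube met by the hyperplane satisfies \<open>real m\<close> \<le>
    \<open>c\<close>; this bound alone leaves finitely many indices.\<close>
  have "m \<le> nat \<lfloor>c\<rfloor>" if "x \<in> diagonal_cube m" "x $ i = c" for m and x :: "real ^ 'd"
    using that by (auto simp: mem_diagonal_cube le_nat_floor)
  then have "{B \<in> diagonal_family n. \<exists>x\<in>B. x $ i = c} \<subseteq> diagonal_cube ` {..nat \<lfloor>c\<rfloor>}"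
    using True by (auto simp: diagonal_family_def)
  then show ?thesis by (rule finite_subset) simp
next
  case False
  \<comment> \<open>Every coordinate of \<open>vec t\<close> is \<open>t\<close>, so only
    \<open>t = c\<close> can lie on the hyperplane.\<close>
  then have "{B \<in> diagonal_family n. \<exists>x\<in>B. x $ i = c} \<subseteq> {{vec c}}"
    by (auto simp: diagonal_family_def)
  then show ?thesis by (rule finite_subset) simp
qed

theorem theorem9:
  fixes k :: nat
  assumes "k < CARD('d::finite)"
  shows "\<exists>\<F> :: nat \<Rightarrow> (real ^ 'd) set set.
           (\<forall>n. \<forall>B \<in> \<F> n. axis_box B) \<and>
           (\<forall>n. \<not> (\<exists>T. finite T \<and> axis_transversal k T (\<F> n))) \<and>
           (\<forall>B :: nat \<Rightarrow> (real ^ 'd) set. (\<forall>n. B n \<in> \<F> n) \<longrightarrow>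
              (\<exists>i j. i \<noteq> j \<and>
                 (\<exists>L. axis_flat k L \<and> B i \<inter> L \<noteq> {} \<and> B j \<inter> L \<noteq> {})))"
proof (intro exI[of _ diagonal_family] conjI allI ballI impI)
  fix n and B :: "(real ^ 'd) set"
  assume "B \<in> diagonal_family n"
  then show "axis_box B" by (rule axis_box_diagonal_family)
next
  fix n
  show "\<not> (\<exists>T. finite T \<and> axis_transversal k T (diagonal_family n :: (real ^ 'd) set set))"
    using assms infinite_diagonal_family finite_diagonal_family_meets_hyperplane
    by (rule no_finite_axis_transversal)
next
  fix B :: "nat \<Rightarrow> (real ^ 'd) set"
  assume B: "\<forall>n. B n \<in> diagonal_family n"
  from B[rule_format, of 0] obtain m where m: "m \<ge> 1" "B 0 = diagonal_cube m"
    by (auto simp: diagonal_family_def)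
  \<comment> \<open>The cube chosen at index 0 dictates where to look next: as \<open>m\<close>
    \<ge> 1, the term \<open>B m\<close> is a point on the diagonal of that very cube, and its index
    differs from 0.\<close>
  from B[rule_format, of m] m(1) obtain t where t: "real m \<le> t" "t \<le> real m + 1" "B m = {vec t}"
    by (auto simp: diagonal_family_def)
  obtain L where L: "axis_flat k L" "(vec t :: real ^ 'd) \<in> L"
    using axis_flat_through_point[OF less_imp_le[OF assms]] by blast
  from m t have "vec t \<in> B 0" "vec t \<in> B m" by (auto simp: mem_diagonal_cube)
  with L have "B 0 \<inter> L \<noteq> {}" "B m \<inter> L \<noteq> {}" by blast+
  with L(1) m(1) show "\<exists>i j. i \<noteq> j \<and> (\<exists>L. axis_flat k L \<and> B i \<inter> L \<noteq> {} \<and> B j \<inter> L \<noteq> {})"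
    by (intro exI[of _ 0] exI[of _ m]) auto
qed

end
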